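(* Let $n\geq 2$. If $n$ is even, then \[ d_{n,n}<d_{n,1}<d_{n,n-1}<d_{n,2}<d_{n,n-2}<\cdots<d_{n,\frac n2+2}<d_{n,\frac n2-1}<d_{n,\frac n2+1}<d_{n,\frac n2}, \] and if $n$ is odd, then \[ d_{n,n}<d_{n,1}<d_{n,n-1}<d_{n,2}<d_{n,n-2}<\cdots<d_{n,\frac{n+3}{2}}<d_{n,\frac{n-1}{2}}<d_{n,\frac{n+1}{2}}. \] Equivalently: with $f(n)=\frac n2-1$ for $n$ even and $f(n)=\frac{n-1}{2}$ for $n$ odd, one has $d_{n,n+1-k}<d_{n,k}<d_{n,n-k}$ for all $1\leq k\leq f(n)$, and additionally $d_{n,n/2+1}<d_{n,n/2}$ when $n$ is even.
   Context: Let $B_n$ be the set of signed permutations $\sigma=\sigma_1\cdots\sigma_n$ of $[n]=\{1,\dots,n\}$ (permutations of $[n]$ in which some entries carry a minus sign). An index $i\in[n]$ is a type $B$ excedance of $\sigma$ if either $\sigma_i=-i$ or $\sigma_{|\sigma_i|}>\sigma_i$; $\mathrm{exc}_B(\sigma)$ denotes the number of type $B$ excedances. A type $B$ derangement is $\sigma\in B_n$ with $\sigma_i\neq i$ for all $i\in[n]$ (entries $\sigma_i=-i$ are allowed); $D_n^B$ is the set of these. For $n\ge1$ and $1\le k\le n$, $d_{n,k}$ denotes the number of $\sigma\in D_n^B$ with exactly $k$ type $B$ excedances. *)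

theory Defs
  imports "HOL-Combinatorics.Permutations"
begin

text \<open>A signed permutation \<open>\<sigma>\<^sub>1\<dots>\<sigma>\<^sub>n\<close> is encoded as a function \<open>\<sigma> :: nat \<Rightarrow> int\<close> with
  \<open>\<sigma> i = \<sigma>\<^sub>i\<close> for \<open>i \<in> {1..n}\<close>. Outside \<open>{1..n}\<close> the value is fixed to \<open>int i\<close>, so that
  each signed permutation is represented by exactly one function.\<close>

definition signed_perms :: "nat \<Rightarrow> (nat \<Rightarrow> int) set" where
  "signed_perms n =
     {\<sigma>. (\<lambda>i. nat \<bar>\<sigma> i\<bar>) permutes {1..n} \<and> (\<forall>i. i \<notin> {1..n} \<longrightarrow> \<sigma> i = int i)}"

definition excB :: "nat \<Rightarrow> (nat \<Rightarrow> int) \<Rightarrow> nat" where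
  "excB n \<sigma> = card {i \<in> {1..n}. \<sigma> i = - int i \<or> \<sigma> (nat \<bar>\<sigma> i\<bar>) > \<sigma> i}"

definition derangementsB :: "nat \<Rightarrow> (nat \<Rightarrow> int) set" where
  "derangementsB n = {\<sigma> \<in> signed_perms n. \<forall>i\<in>{1..n}. \<sigma> i \<noteq> int i}"

definition num_derB :: "nat \<Rightarrow> nat \<Rightarrow> nat" where
  "num_derB n k = card {\<sigma> \<in> derangementsB n. excB n \<sigma> = k}"

text \<open>The indices \<open>n, 1, n - 1, 2, n - 2, \<dots>\<close> in the order in which they occur in the chain
  of inequalities. For even \<open>n\<close> the last pair is \<open>n/2 + 1, n/2\<close>; for odd \<open>n\<close> the last pair
  is \<open>(n+3)/2, (n-1)/2\<close>, and it is followed by the middle index \<open>(n+1)/2\<close>.\<close>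

definition chain_indices :: "nat \<Rightarrow> nat list" where
  "chain_indices n =
     concat (map (\<lambda>j. [n + 1 - j, j]) [1..<n div 2 + 1]) @ (if odd n then [(n + 1) div 2] else [])"

definition half_bound :: "nat \<Rightarrow> nat" where
  "half_bound n = (if even n then n div 2 - 1 else (n - 1) div 2)"

text \<open>So \<^const>\<open>num_derB\<close> never takes the cardinality of an infinite set.\<close>

lemma finite_signed_perms: "finite (signed_perms n)"
proof (rule finite_subset)
  let ?g = "\<lambda>h i. if i \<in> {1..n} then h i else int i"
  show "signed_perms n \<subseteq> ?g ` PiE {1..n} (\<lambda>_. {- int n..int n})"
  proof
    fix \<sigma> assume s: "\<sigma> \<in> signed_perms n"
    have b: "\<sigma> i \<in> {- int n..int n}" if "i \<in> {1..n}" for i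
    proof -
      have "nat \<bar>\<sigma> i\<bar> \<in> {1..n}"
        using s that permutes_in_image[of "\<lambda>i. nat \<bar>\<sigma> i\<bar>" "{1..n}" i]
        by (simp add: signed_perms_def)
      then show ?thesis by auto
    qed
    have "\<sigma> = ?g (restrict \<sigma> {1..n})"
      using s by (auto simp: signed_perms_def)
    moreover have "restrict \<sigma> {1..n} \<in> PiE {1..n} (\<lambda>_. {- int n..int n})"
      using b by (auto simp: PiE_def)
    ultimately show "\<sigma> \<in> ?g ` PiE {1..n} (\<lambda>_. {- int n..int n})" by blast
  qed
  show "finite (?g ` PiE {1..n} (\<lambda>_. {- int n..int n}))"
    by (intro finite_imageI finite_PiE) auto
qed

end

theory Submission
  imports Defs
begin

text \<open>
  Write a signed permutation as a product of cycles of signed letters, where \<open>c\<close> is followed by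
  \<open>\<sigma>\<^bsub>|c|\<^esub>\<close>. Apart from the one-letter cycles, a type B excedance is then just a cyclic
  ascent. Inserting a letter \<open>\<plusminus>n\<close> into a gap between two consecutive letters creates exactly one
  ascent and one descent in place of whatever was there, for either sign. Counting by fixed points
  and excedances simultaneously turns this into a recurrence, which is solved by
  (n choose f) times the number of derangements of size \<open>n - f\<close>, and so
  \<open>d n k = 2k \<cdot> d (n-1) k + (2(n-k)+1) \<cdot> d (n-1) (k-1) + 2(n-1) \<cdot> d (n-2) (k-1)\<close>.
  The coefficients of the first two terms add up to \<open>2n + 1\<close> for every \<open>k\<close>, so both inequalities
  of the spiral follow by induction from comparing two weighted sums of four consecutive
  entries of the chain for \<open>n - 1\<close>.
\<close>

section \<open>Excedances and fixed points, and the insertion of a letter\<close>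

text \<open>Kept as a set rather than a number, because the effect of an insertion depends on
  whether one particular index belongs to it.\<close>

definition exc_set :: "nat \<Rightarrow> (nat \<Rightarrow> int) \<Rightarrow> nat set" where
  "exc_set n \<sigma> = {i \<in> {1..n}. \<sigma> i = - int i \<or> \<sigma> (nat \<bar>\<sigma> i\<bar>) > \<sigma> i}"

definition fix_set :: "nat \<Rightarrow> (nat \<Rightarrow> int) \<Rightarrow> nat set" where
  "fix_set n \<sigma> = {i \<in> {1..n}. \<sigma> i = int i}"

text \<open>An insertion at a fixed point destroys that fixed point, so derangements also arise from
  smaller non-derangements. Counting by both statistics makes the recurrence close up.\<close>

definition num_fix_exc :: "nat \<Rightarrow> nat \<Rightarrow> nat \<Rightarrow> nat" where
  "num_fix_exc n f k = card {\<sigma> \<in> signed_perms n. card (fix_set n \<sigma>) = f \<and> card (exc_set n \<sigma>) = k}"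

text \<open>In cycle notation, the letter \<open>x = \<plusminus>n\<close> is inserted between the letter of absolute value \<open>i\<close> and
  its successor \<open>\<tau>\<^sub>i\<close>; for \<open>i = n\<close> it forms a new one-letter cycle.\<close>

definition insert_letter :: "nat \<Rightarrow> (nat \<Rightarrow> int) \<Rightarrow> nat \<Rightarrow> int \<Rightarrow> nat \<Rightarrow> int" where
  "insert_letter n \<tau> i x = \<tau>(n := \<tau> i, i := x)"

section \<open>Insertion of the largest letter as a bijection\<close>

lemma signed_perms_permutes: "\<sigma> \<in> signed_perms n \<Longrightarrow> (\<lambda>i. nat \<bar>\<sigma> i\<bar>) permutes {1..n}"
  by (simp add: signed_perms_def)

lemma signed_perms_outside: "\<sigma> \<in> signed_perms n \<Longrightarrow> i \<notin> {1..n} \<Longrightarrow> \<sigma> i = int i"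
  by (simp add: signed_perms_def)

lemma signed_perms_inj:
  assumes "\<sigma> \<in> signed_perms n" "\<bar>\<sigma> i\<bar> = \<bar>\<sigma> j\<bar>"
  shows "i = j"
  using injD[OF permutes_inj[OF signed_perms_permutes[OF assms(1)]], of i j] assms(2) by simp

lemma insert_letter_in_signed_perms:
  assumes t: "\<tau> \<in> signed_perms m" and i: "i \<in> {1..Suc m}" and x: "\<bar>x\<bar> = int (Suc m)"
  shows "insert_letter (Suc m) \<tau> i x \<in> signed_perms (Suc m)"
proof -
  \<comment> \<open>On absolute values, insertion is composition with a transposition. This uses the
    default value of \<open>\<tau>\<close> at \<open>Suc m\<close>.\<close>
  have "(\<lambda>j. nat \<bar>insert_letter (Suc m) \<tau> i x j\<bar>) = (\<lambda>j. nat \<bar>\<tau> j\<bar>) \<circ> Transposition.transpose i (Suc m)"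
    using x signed_perms_outside[OF t, of "Suc m"]
    by (auto simp: fun_eq_iff insert_letter_def Transposition.transpose_def nat_add_distrib)
  moreover have "\<dots> permutes {1..Suc m}"
  proof (rule permutes_compose)
    show "Transposition.transpose i (Suc m) permutes {1..Suc m}"
      using i by (intro permutes_swap_id) auto
    show "(\<lambda>j. nat \<bar>\<tau> j\<bar>) permutes {1..Suc m}"
      by (rule permutes_subset[OF signed_perms_permutes[OF t]]) auto
  qed
  moreover have "insert_letter (Suc m) \<tau> i x j = int j" if "j \<notin> {1..Suc m}" for j
    using that i signed_perms_outside[OF t, of j] by (auto simp: insert_letter_def)
  ultimately show ?thesis by (simp add: signed_perms_def)
qed

text \<open>The same transposition undoes an insertion. Restoring the default value at
  \<open>Suc m\<close> forgets the sign of the deleted letter, which the bijection below stores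
  separately.\<close>

lemma delete_letter_in_signed_perms:
  assumes s: "\<sigma> \<in> signed_perms (Suc m)" and i: "\<bar>\<sigma> i\<bar> = int (Suc m)"
  shows "\<sigma>(i := \<sigma> (Suc m), Suc m := int (Suc m)) \<in> signed_perms m" (is "?t \<in> _")
proof -
  have ir: "i \<in> {1..Suc m}"
    using signed_perms_outside[OF s, of i] i by (cases "i \<in> {1..Suc m}") auto
  have "(\<lambda>j. nat \<bar>?t j\<bar>) = (\<lambda>j. nat \<bar>\<sigma> j\<bar>) \<circ> Transposition.transpose i (Suc m)"
    using i by (auto simp: fun_eq_iff Transposition.transpose_def nat_add_distrib)
  moreover have "\<dots> permutes {1..Suc m}"
  proof (rule permutes_compose)
    show "Transposition.transpose i (Suc m) permutes {1..Suc m}"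
      using ir by (intro permutes_swap_id) auto
  qed (rule signed_perms_permutes[OF s])
  ultimately have "(\<lambda>j. nat \<bar>?t j\<bar>) permutes {1..Suc m}" by simp
  then have "(\<lambda>j. nat \<bar>?t j\<bar>) permutes {1..m}"
    by (rule permutes_superset) (auto simp: atLeastAtMostSuc_conv nat_add_distrib)
  moreover have "?t j = int j" if "j \<notin> {1..m}" for j
    using that ir signed_perms_outside[OF s, of j] by (cases "j = Suc m") auto
  ultimately show ?thesis by (simp add: signed_perms_def)
qed

lemma bij_betw_insert_letter:
  "bij_betw (\<lambda>(\<tau>, i, x). insert_letter (Suc m) \<tau> i x)
     (signed_perms m \<times> {1..Suc m} \<times> {int (Suc m), - int (Suc m)}) (signed_perms (Suc m))"
proof -
  \<comment> \<open>\<open>pos\<close> locates the letter of largest absolute value; its position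
    and signed value are the data that invert the insertion.\<close>
  define pos where "pos \<sigma> = (THE i. \<bar>\<sigma> i\<bar> = int (Suc m))" for \<sigma> :: "nat \<Rightarrow> int"
  have pos_eq: "pos \<sigma> = i" if "\<sigma> \<in> signed_perms (Suc m)" "\<bar>\<sigma> i\<bar> = int (Suc m)" for \<sigma> i
    unfolding pos_def using that signed_perms_inj[OF that(1)] by (intro the_equality) auto
  have ex: "\<bar>\<sigma> (pos \<sigma>)\<bar> = int (Suc m)" "pos \<sigma> \<in> {1..Suc m}" if s: "\<sigma> \<in> signed_perms (Suc m)" for \<sigma>
  proof -
    have "Suc m \<in> (\<lambda>i. nat \<bar>\<sigma> i\<bar>) ` {1..Suc m}"
      using permutes_image[OF signed_perms_permutes[OF s]] by simp
    then obtain i where "i \<in> {1..Suc m}" "\<bar>\<sigma> i\<bar> = int (Suc m)" by fastforce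
    with pos_eq[OF s] show "\<bar>\<sigma> (pos \<sigma>)\<bar> = int (Suc m)" "pos \<sigma> \<in> {1..Suc m}" by auto
  qed
  show ?thesis
  proof (rule bij_betw_byWitness[where f' =
      "\<lambda>\<sigma>. (\<sigma>(pos \<sigma> := \<sigma> (Suc m), Suc m := int (Suc m)), pos \<sigma>, \<sigma> (pos \<sigma>))"], goal_cases)
    case 1
    show ?case
    proof
      fix a assume "a \<in> signed_perms m \<times> {1..Suc m} \<times> {int (Suc m), - int (Suc m)}"
      then obtain \<tau> i x where a: "a = (\<tau>, i, x)" and t: "\<tau> \<in> signed_perms m"
        and i: "i \<in> {1..Suc m}" and x: "x \<in> {int (Suc m), - int (Suc m)}" by blast
      let ?s = "insert_letter (Suc m) \<tau> i x"
      have ax: "\<bar>x\<bar> = int (Suc m)" using x by auto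
      have si: "?s i = x" by (simp add: insert_letter_def)
      have p: "pos ?s = i"
        by (rule pos_eq[OF insert_letter_in_signed_perms[OF t i ax]]) (simp add: si ax)
      have "\<tau> (Suc m) = int (Suc m)" using signed_perms_outside[OF t, of "Suc m"] by simp
      then have "?s(i := ?s (Suc m), Suc m := int (Suc m)) = \<tau>"
        by (auto simp: insert_letter_def fun_eq_iff)
      with p si show "(\<lambda>\<sigma>. (\<sigma>(pos \<sigma> := \<sigma> (Suc m), Suc m := int (Suc m)), pos \<sigma>, \<sigma> (pos \<sigma>)))
          (case a of (\<tau>, i, x) \<Rightarrow> insert_letter (Suc m) \<tau> i x) = a"
        by (simp only: a Let_def prod.case)
    qed
  next
    case 2
    show ?case by (auto simp: insert_letter_def fun_eq_iff)
  next
    case 3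
    show ?case using insert_letter_in_signed_perms by auto
  next
    case 4
    have "\<sigma> (pos \<sigma>) \<in> {int (Suc m), - int (Suc m)}" if "\<sigma> \<in> signed_perms (Suc m)" for \<sigma>
      using ex(1)[OF that] by (auto simp: abs_if split: if_splits)
    then show ?case using ex delete_letter_in_signed_perms by blast
  qed
qed

section \<open>Effect of an insertion on fixed points and excedances\<close>

text \<open>Inserting after the letter \<open>\<tau>\<^sub>p\<close> means inserting at the gap whose ascent is recorded by the
  index \<open>p\<close>.\<close>

lemma fix_set_insert_letter:
  assumes t: "\<tau> \<in> signed_perms m" and p: "p \<in> {1..m}" and x: "\<bar>x\<bar> = int (Suc m)"
  shows "fix_set (Suc m) (insert_letter (Suc m) \<tau> (nat \<bar>\<tau> p\<bar>) x) = fix_set m \<tau> - {p}"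
proof -
  define i where "i = nat \<bar>\<tau> p\<bar>"
  have i: "i \<in> {1..m}" "\<bar>\<tau> p\<bar> = int i"
    using permutes_in_image[OF signed_perms_permutes[OF t], of p] p by (auto simp: i_def)
  have n: "\<tau> i \<noteq> int (Suc m)"
    using permutes_in_image[OF signed_perms_permutes[OF t], of i] i by auto
  \<comment> \<open>\<open>i = p\<close> means that the gap lies in a one-letter cycle. Hence
    overwriting the value at \<open>i\<close> destroys no fixed point other than
    \<open>p\<close>.\<close>
  have ip: "i = p \<longleftrightarrow> \<bar>\<tau> i\<bar> = int i"
  proof
    assume "\<bar>\<tau> i\<bar> = int i"
    then have "\<bar>\<tau> i\<bar> = \<bar>\<tau> p\<bar>" using i by linarith
    then show "i = p" by (rule signed_perms_inj[OF t])
  qed (use i in simp)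
  let ?s = "insert_letter (Suc m) \<tau> i x"
  have "q \<in> fix_set (Suc m) ?s \<longleftrightarrow> q \<in> fix_set m \<tau> - {p}" for q
  proof (cases "q = Suc m")
    case True
    then show ?thesis using i n by (simp add: fix_set_def insert_letter_def)
  next
    case False
    show ?thesis
    proof (cases "q = i")
      case True
      then have "q \<in> fix_set m \<tau> \<Longrightarrow> q = p" using ip by (simp add: fix_set_def)
      moreover have "q \<notin> fix_set (Suc m) ?s" using True i x by (auto simp: fix_set_def insert_letter_def)
      ultimately show ?thesis by blast
    next
      case qi: False
      have "p \<notin> fix_set m \<tau>" if "q = p" using that qi i by (auto simp: fix_set_def)
      moreover have "q \<in> fix_set (Suc m) ?s \<longleftrightarrow> q \<in> fix_set m \<tau>"
        using False qi by (auto simp: fix_set_def insert_letter_def)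
      ultimately show ?thesis by blast
    qed
  qed
  then show ?thesis unfolding i_def by blast
qed

text \<open>The pair of consecutive letters recorded by \<open>p\<close> gives way to two pairs,
  into \<open>x\<close> and out of \<open>x\<close>. Since \<open>x\<close> exceeds all other
  letters in absolute value, exactly one of the two is an ascent, whatever the sign of
  \<open>x\<close>.\<close>

lemma card_exc_set_insert_letter:
  assumes t: "\<tau> \<in> signed_perms m" and p: "p \<in> {1..m}" and x: "\<bar>x\<bar> = int (Suc m)"
  shows "card (exc_set (Suc m) (insert_letter (Suc m) \<tau> (nat \<bar>\<tau> p\<bar>) x))
    = Suc (card (exc_set m \<tau> - {p}))"
proof -
  define i where "i = nat \<bar>\<tau> p\<bar>"
  define n where "n = Suc m"
  define \<sigma> where "\<sigma> = insert_letter n \<tau> i x"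
  have rng: "nat \<bar>\<tau> q\<bar> \<in> {1..m}" if "q \<in> {1..m}" for q
    using permutes_in_image[OF signed_perms_permutes[OF t], of q] that by simp
  have i: "i \<in> {1..m}" "\<bar>\<tau> p\<bar> = int i" using rng[OF p] by (auto simp: i_def)
  have lt: "\<bar>\<tau> q\<bar> < \<bar>x\<bar>" if "q \<in> {1..m}" for q using rng[OF that] x by auto
  have s: "\<sigma> n = \<tau> i" "\<sigma> i = x" "\<And>q. q \<noteq> n \<Longrightarrow> q \<noteq> i \<Longrightarrow> \<sigma> q = \<tau> q"
    using i by (auto simp: \<sigma>_def insert_letter_def n_def)
  have nat_x: "nat \<bar>x\<bar> = n" "i \<noteq> n" "p \<noteq> n" using x i p by (auto simp: n_def)
  have sgn_x: "x > 0 \<longleftrightarrow> \<not> x < 0" using x by linarith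
  have sub: "exc_set m \<tau> \<subseteq> {1..m}" "exc_set n \<sigma> \<subseteq> {1..n}" by (auto simp: exc_set_def)
  have fin: "finite (exc_set m \<tau>)" "finite (exc_set n \<sigma>)"
    using sub finite_subset by blast+
  \<comment> \<open>Only at \<open>p\<close> is the next letter read off at position
    \<open>i\<close>, so these indices keep both their letter and its successor.\<close>
  have other: "q \<in> exc_set n \<sigma> \<longleftrightarrow> q \<in> exc_set m \<tau>" if "q \<noteq> n" "q \<noteq> i" "q \<noteq> p" for q
  proof (cases "q \<in> {1..m}")
    case True
    have "nat \<bar>\<tau> q\<bar> \<noteq> i"
    proof
      assume "nat \<bar>\<tau> q\<bar> = i"
      then have "\<bar>\<tau> q\<bar> = \<bar>\<tau> p\<bar>" using i by linarith
      from signed_perms_inj[OF t this] that show False by simp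
    qed
    moreover have "nat \<bar>\<tau> q\<bar> \<noteq> n" using rng[OF True] by (auto simp: n_def)
    ultimately show ?thesis using s that True by (simp add: exc_set_def n_def)
  next
    case False
    with that sub show ?thesis by (auto simp: n_def atLeastAtMostSuc_conv)
  qed
  have ie: "i \<in> exc_set n \<sigma> \<longleftrightarrow> x < 0"
    using s nat_x i lt[OF i(1)] by (auto simp: exc_set_def n_def)
  have "card (exc_set n \<sigma>) = Suc (card (exc_set m \<tau> - {p}))"
  proof (cases "p = i")
    \<comment> \<open>A one-letter cycle grows into a two-letter cycle recorded by \<open>i\<close>
      and \<open>n\<close>, so the clause for one-letter cycles no longer applies to it.\<close>
    case True
    have "nat \<bar>\<tau> i\<bar> = i" using i True by auto
    then have ne: "n \<in> exc_set n \<sigma> \<longleftrightarrow> x > 0"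
      using s nat_x i lt[OF i(1)] by (auto simp: exc_set_def n_def)
    have "exc_set n \<sigma> = insert (if x < 0 then i else n) (exc_set m \<tau> - {i})"
    proof (rule set_eqI)
      fix q
      have "n \<notin> exc_set m \<tau>" using sub by (auto simp: n_def)
      then show "q \<in> exc_set n \<sigma> \<longleftrightarrow> q \<in> insert (if x < 0 then i else n) (exc_set m \<tau> - {i})"
        using other[of q] ie ne True sgn_x nat_x(2) by (cases "q = n"; cases "q = i") simp_all
    qed
    moreover have "(if x < 0 then i else n) \<notin> exc_set m \<tau> - {i}"
      using sub by (auto simp: n_def)
    ultimately show ?thesis using fin True by simp
  next
    case False
    have a: "nat \<bar>\<tau> i\<bar> \<noteq> i"
    proof
      assume "nat \<bar>\<tau> i\<bar> = i"
      then have "\<bar>\<tau> i\<bar> = \<bar>\<tau> p\<bar>" using i by linarith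
      from signed_perms_inj[OF t this] False show False by simp
    qed
    have b: "nat \<bar>\<tau> i\<bar> \<in> {1..m}" by (rule rng) (use i in auto)
    \<comment> \<open>The old letter at \<open>i\<close> has moved to position \<open>n\<close>,
      which inherits its status; \<open>a\<close> rules out the clause for one-letter
      cycles.\<close>
    have ne: "n \<in> exc_set n \<sigma> \<longleftrightarrow> i \<in> exc_set m \<tau>"
      using s a b i by (auto simp: exc_set_def n_def)
    have pe: "p \<in> exc_set n \<sigma> \<longleftrightarrow> x > 0"
      using s nat_x i p lt[OF p] False by (auto simp: exc_set_def n_def)
    let ?R = "exc_set m \<tau> - {p, i}"
    have R: "finite ?R" "n \<notin> ?R" "i \<notin> ?R" "p \<notin> ?R" using fin sub by (auto simp: n_def)
    have "exc_set n \<sigma> = insert (if x < 0 then i else p) (if i \<in> exc_set m \<tau> then insert n ?R else ?R)"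
    proof (rule set_eqI)
      fix q
      consider "q = n" | "q = i" | "q = p" | "q \<noteq> n" "q \<noteq> i" "q \<noteq> p" by blast
      then show "q \<in> exc_set n \<sigma> \<longleftrightarrow>
          q \<in> insert (if x < 0 then i else p) (if i \<in> exc_set m \<tau> then insert n ?R else ?R)"
      proof cases
        case 1
        then show ?thesis using ne nat_x(2,3) R(2) by simp
      next
        case 2
        then show ?thesis using ie nat_x(2) False by simp
      next
        case 3
        then show ?thesis using pe nat_x(3) False sgn_x by simp
      next
        case 4
        then show ?thesis using other[of q] by simp
      qed
    qed
    then have "card (exc_set n \<sigma>) = Suc (if i \<in> exc_set m \<tau> then Suc (card ?R) else card ?R)"
      using R nat_x by auto
    moreover have "exc_set m \<tau> - {p} = (if i \<in> exc_set m \<tau> then insert i ?R else ?R)"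
      using False by auto
    then have "card (exc_set m \<tau> - {p}) = (if i \<in> exc_set m \<tau> then Suc (card ?R) else card ?R)"
      using R by auto
    ultimately show ?thesis by simp
  qed
  then show ?thesis unfolding \<sigma>_def i_def n_def .
qed

lemma fix_set_insert_last:
  assumes x: "\<bar>x\<bar> = int (Suc m)"
  shows "fix_set (Suc m) (insert_letter (Suc m) \<tau> (Suc m) x)
    = (if x > 0 then insert (Suc m) (fix_set m \<tau>) else fix_set m \<tau>)"
  using x by (auto simp: fix_set_def insert_letter_def)

text \<open>The new letter forms a cycle of its own, to which no other letter leads. If negative, it
  is an excedance by the clause \<open>\<sigma> i = - int i\<close>.\<close>

lemma exc_set_insert_last:
  assumes t: "\<tau> \<in> signed_perms m" and x: "\<bar>x\<bar> = int (Suc m)"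
  shows "exc_set (Suc m) (insert_letter (Suc m) \<tau> (Suc m) x)
    = (if x > 0 then exc_set m \<tau> else insert (Suc m) (exc_set m \<tau>))"
proof -
  have "nat \<bar>\<tau> q\<bar> \<noteq> Suc m" if "q \<in> {1..m}" for q
    using permutes_in_image[OF signed_perms_permutes[OF t], of q] that by auto
  moreover have "nat \<bar>x\<bar> = Suc m" using x by simp
  moreover have "x = int (Suc m) \<or> x = - int (Suc m)" using x by linarith
  ultimately show ?thesis
    by (auto simp: exc_set_def insert_letter_def atLeastAtMostSuc_conv)
qed

section \<open>The recurrence for the joint count\<close>

lemma sum_split_by_three_values:
  fixes u v w :: nat
  assumes "finite A" "E \<subseteq> A" "F \<subseteq> A" "E \<inter> F = {}"
  shows "(\<Sum>p\<in>A. if p \<in> E then u else if p \<in> F then v else w)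
    = card E * u + card F * v + (card A - card E - card F) * w"
proof -
  have fin: "finite E" "finite F" using assms by (auto intro: finite_subset)
  have "(\<Sum>p\<in>A. if p \<in> E then u else if p \<in> F then v else w)
      = (\<Sum>p\<in>E. u) + (\<Sum>p\<in>A - E. if p \<in> F then v else w)"
    using assms(1,2) by (simp add: sum.If_cases Int_absorb1 Diff_eq)
  also have "(\<Sum>p\<in>A - E. if p \<in> F then v else w) = (\<Sum>p\<in>F. v) + (\<Sum>p\<in>A - E - F. w)"
  proof -
    have "(A - E) \<inter> F = F" using assms by blast
    then show ?thesis using assms(1) by (simp add: sum.If_cases Diff_eq)
  qed
  finally have "(\<Sum>p\<in>A. if p \<in> E then u else if p \<in> F then v else w)
      = card E * u + card F * v + card (A - E - F) * w" by simp
  moreover have "card (A - E - F) = card A - card E - card F"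
  proof -
    have "F \<subseteq> A - E" using assms by blast
    then show ?thesis using assms fin by (simp add: card_Diff_subset)
  qed
  ultimately show ?thesis by simp
qed

lemma exc_fix_subset: "exc_set n \<sigma> \<subseteq> {1..n}" "fix_set n \<sigma> \<subseteq> {1..n}"
  by (auto simp: exc_set_def fix_set_def)

lemma exc_fix_disjoint: "exc_set n \<sigma> \<inter> fix_set n \<sigma> = {}"
  by (auto simp: exc_set_def fix_set_def)

lemma num_fix_exc_eq_sum:
  "num_fix_exc n f k
    = (\<Sum>\<sigma>\<in>signed_perms n. of_bool (card (fix_set n \<sigma>) = f \<and> card (exc_set n \<sigma>) = k))"
  using finite_signed_perms[of n]
  by (simp add: num_fix_exc_def of_bool_def sum.If_cases Int_def)

text \<open>The first two terms come from a new one-letter cycle. Otherwise the gap is at one of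
  \<open>b\<close> excedances, where both counts survive, at one of \<open>a\<close> fixed points,
  where a fixed point is traded for an excedance, or at a remaining index, where an excedance is
  gained. The factor 2 accounts for the sign.\<close>

lemma sum_insert_letter:
  fixes f k :: nat
  assumes t: "\<tau> \<in> signed_perms m"
  defines "a \<equiv> card (fix_set m \<tau>)" and "b \<equiv> card (exc_set m \<tau>)"
    and "g \<equiv> \<lambda>\<sigma>. of_bool (card (fix_set (Suc m) \<sigma>) = f \<and> card (exc_set (Suc m) \<sigma>) = k)"
  shows "(\<Sum>i\<in>{1..Suc m}. \<Sum>x\<in>{int (Suc m), - int (Suc m)}. g (insert_letter (Suc m) \<tau> i x))
    = of_bool (Suc a = f \<and> b = k) + of_bool (a = f \<and> Suc b = k)
      + 2 * (b * of_bool (a = f \<and> b = k) + a * of_bool (a = Suc f \<and> Suc b = k)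
             + (m - b - a) * of_bool (a = f \<and> Suc b = k))" (is "?lhs = ?rhs")
proof -
  let ?E = "exc_set m \<tau>" and ?F = "fix_set m \<tau>"
  let ?G = "\<lambda>i. \<Sum>x\<in>{int (Suc m), - int (Suc m)}. g (insert_letter (Suc m) \<tau> i x)"
  have sub: "?E \<subseteq> {1..m}" "?F \<subseteq> {1..m}" by (rule exc_fix_subset)+
  have fin: "finite ?E" "finite ?F" using sub finite_subset by blast+
  have nin: "Suc m \<notin> ?E" "Suc m \<notin> ?F" using sub by auto
  have last: "?G (Suc m) = of_bool (Suc a = f \<and> b = k) + of_bool (a = f \<and> Suc b = k)"
    using fin nin
    by (simp add: g_def fix_set_insert_last exc_set_insert_last[OF t] a_def b_def
        del: of_nat_Suc)
  have "?G (nat \<bar>\<tau> p\<bar>) = (if p \<in> ?E then 2 * of_bool (a = f \<and> b = k)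
      else if p \<in> ?F then 2 * of_bool (a = Suc f \<and> Suc b = k)
      else 2 * of_bool (a = f \<and> Suc b = k))" if p: "p \<in> {1..m}" for p
  proof -
    have "?G (nat \<bar>\<tau> p\<bar>) = 2 * of_bool (card (?F - {p}) = f \<and> Suc (card (?E - {p})) = k)"
      by (simp add: g_def fix_set_insert_letter[OF t p] card_exc_set_insert_letter[OF t p]
          del: of_nat_Suc)
    moreover have "card (?F - {p}) = a - 1" "a > 0" if "p \<in> ?F"
      using that fin card_gt_0_iff by (auto simp: a_def)
    moreover have "card (?E - {p}) = b - 1" "b > 0" if "p \<in> ?E"
      using that fin card_gt_0_iff by (auto simp: b_def)
    moreover have "p \<notin> ?F \<Longrightarrow> ?F - {p} = ?F" "p \<notin> ?E \<Longrightarrow> ?E - {p} = ?E" by auto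
    moreover have "p \<notin> ?F \<or> p \<notin> ?E" using exc_fix_disjoint by blast
    moreover have "(a - 1 = f) = (a = Suc f)" if "a > 0" using that by auto
    ultimately show ?thesis by (auto simp: a_def b_def)
  qed
  then have "(\<Sum>p\<in>{1..m}. ?G (nat \<bar>\<tau> p\<bar>))
      = (\<Sum>p\<in>{1..m}. if p \<in> ?E then 2 * of_bool (a = f \<and> b = k)
      else if p \<in> ?F then 2 * of_bool (a = Suc f \<and> Suc b = k)
      else 2 * of_bool (a = f \<and> Suc b = k))" by (rule sum.cong[OF refl])
  also have "\<dots> = 2 * (b * of_bool (a = f \<and> b = k) + a * of_bool (a = Suc f \<and> Suc b = k)
             + (m - b - a) * of_bool (a = f \<and> Suc b = k))"
    by (subst sum_split_by_three_values) (use sub exc_fix_disjoint in \<open>auto simp: a_def b_def\<close>)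
  \<comment> \<open>Positions \<open>i\<close> may be renamed as gaps \<open>p\<close>, because the
    absolute values of \<open>\<tau>\<close> permute \<open>{1..m}\<close>.\<close>
  finally have "(\<Sum>i\<in>{1..m}. ?G i) = \<dots>"
    using sum.permute[OF signed_perms_permutes[OF t], of ?G] by (simp only: comp_def)
  then show ?thesis using last by (simp only: sum.nat_ivl_Suc' le_SucI atLeastAtMostSuc_conv)
       (simp add: algebra_simps)
qed

lemma num_fix_exc_Suc:
  "num_fix_exc (Suc m) f k
    = (if f = 0 then 0 else num_fix_exc m (f - 1) k) + 2 * k * num_fix_exc m f k
      + (if k = 0 then 0 else (2 * (Suc m - k - f) + 1) * num_fix_exc m f (k - 1)
           + 2 * Suc f * num_fix_exc m (Suc f) (k - 1))"
proof -
  let ?a = "\<lambda>\<tau>. card (fix_set m \<tau>)" and ?b = "\<lambda>\<tau>. card (exc_set m \<tau>)"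
  let ?g = "\<lambda>\<sigma>. of_bool (card (fix_set (Suc m) \<sigma>) = f \<and> card (exc_set (Suc m) \<sigma>) = k) :: nat"
  have "num_fix_exc (Suc m) f k = (\<Sum>(\<tau>, i, x) \<in>
      signed_perms m \<times> {1..Suc m} \<times> {int (Suc m), - int (Suc m)}. ?g (insert_letter (Suc m) \<tau> i x))"
    unfolding num_fix_exc_eq_sum
    by (subst sum.reindex_bij_betw[OF bij_betw_insert_letter, symmetric])
      (simp only: case_prod_unfold)
  also have "\<dots> = (\<Sum>\<tau>\<in>signed_perms m. \<Sum>i\<in>{1..Suc m}. \<Sum>x\<in>{int (Suc m), - int (Suc m)}.
      ?g (insert_letter (Suc m) \<tau> i x))"
    by (simp only: sum.cartesian_product)
  \<comment> \<open>With \<open>k - 1\<close> excedances before the insertion,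
    \<open>m - b - a\<close> becomes \<open>Suc m - k - f\<close>; the extra 1 is the new negative
    one-letter cycle. The tests for 0 guard the truncated predecessors.\<close>
  also have "\<dots> = (\<Sum>\<tau>\<in>signed_perms m.
      (if f = 0 then 0 else of_bool (?a \<tau> = f - 1 \<and> ?b \<tau> = k)) + 2 * k * of_bool (?a \<tau> = f \<and> ?b \<tau> = k)
      + (if k = 0 then 0 else (2 * (Suc m - k - f) + 1) * of_bool (?a \<tau> = f \<and> ?b \<tau> = k - 1)
           + 2 * Suc f * of_bool (?a \<tau> = Suc f \<and> ?b \<tau> = k - 1)))"
    by (intro sum.cong refl, subst sum_insert_letter) (cases f; cases k; auto)+
  also have "\<dots> = (if f = 0 then 0 else num_fix_exc m (f - 1) k) + 2 * k * num_fix_exc m f k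
      + (if k = 0 then 0 else (2 * (Suc m - k - f) + 1) * num_fix_exc m f (k - 1)
           + 2 * Suc f * num_fix_exc m (Suc f) (k - 1))"
    unfolding num_fix_exc_eq_sum by (simp add: sum.distrib sum_distrib_left)
  finally show ?thesis .
qed

lemma num_fix_exc_0: "num_fix_exc 0 f k = of_bool (f = 0 \<and> k = 0)"
proof -
  have "signed_perms 0 = {int}"
    by (auto simp: signed_perms_def fun_eq_iff)
  then show ?thesis
    by (simp add: num_fix_exc_eq_sum fix_set_def exc_set_def)
qed

lemma num_fix_exc_eq_0:
  assumes "n < f \<or> n < k"
  shows "num_fix_exc n f k = 0"
proof -
  have "card (fix_set n \<sigma>) \<le> n" "card (exc_set n \<sigma>) \<le> n" for \<sigma>
    using card_mono[OF _ exc_fix_subset(1)[of n \<sigma>]] card_mono[OF _ exc_fix_subset(2)[of n \<sigma>]]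
    by simp_all
  then have "{\<sigma> \<in> signed_perms n. card (fix_set n \<sigma>) = f \<and> card (exc_set n \<sigma>) = k} = {}"
    using assms by (auto simp: not_less[symmetric])
  then show ?thesis by (simp only: num_fix_exc_def card.empty)
qed

section \<open>Splitting off the fixed points\<close>

lemma Suc_times_binomial_Suc: "Suc f * (m choose Suc f) = (m - f) * (m choose f)"
proof (cases "f \<le> m")
  case True
  then obtain d where d: "m = f + d" using le_Suc_ex by blast
  show ?thesis using Suc_times_binomial_eq[of m f] by (simp add: d algebra_simps)
qed (simp add: binomial_eq_0)

text \<open>Instead of removing the fixed points and relabelling the rest, the proof checks that the
  right-hand side obeys the same recurrence. Pascal's rule separates the case in which the letter
  \<open>n\<close> is a fixed point.\<close>

lemma num_fix_exc_eq_binomial: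
  "num_fix_exc n f k = (n choose f) * num_fix_exc (n - f) 0 k"
proof (induction n arbitrary: f k rule: less_induct)
  case (less n)
  \<comment> \<open>The case \<open>f = n\<close> stands apart: only for smaller \<open>f\<close> is
    \<open>n - f\<close> the successor of \<open>m - f\<close>.\<close>
  have "f = 0 \<or> f > n \<or> (\<exists>m g. n = Suc m \<and> f = Suc g \<and> (f = n \<or> f \<le> m))"
    by (cases n; cases f) auto
  then consider "f = 0" | "f > n" | m g where "n = Suc m" "f = Suc g" "f = n"
    | m g where "n = Suc m" "f = Suc g" "f \<le> m" by blast
  then show ?case
  proof cases
    case 1
    then show ?thesis by simp
  next
    case 2
    then show ?thesis by (simp add: num_fix_exc_eq_0 binomial_eq_0)
  next
    case 3
    then show ?thesis
      using less.IH[of m g k] by (simp add: num_fix_exc_Suc[of g] num_fix_exc_eq_0)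
  next
    case 4
    define l where "l = m - f"
    define D where "D = (\<lambda>k. num_fix_exc l 0 k)"
    \<comment> \<open>For \<open>l = 0\<close> the subtraction is truncated, but \<open>D'\<close>
      then occurs only with a factor that vanishes.\<close>
    define D' where "D' = (\<lambda>k. num_fix_exc (l - 1) 0 k)"
    define c where "c = (m choose f)"
    have l: "n - f = Suc l" "m - g = Suc l" "\<And>k. Suc m - k - f = Suc l - k"
      using 4 by (auto simp: l_def)
    have ih: "num_fix_exc m g k = (m choose g) * num_fix_exc (Suc l) 0 k"
      "num_fix_exc m f k = c * D k" for k
      using less.IH[of m g k] less.IH[of m f k] 4 l by (simp_all add: l_def D_def c_def)
    have "num_fix_exc m (Suc f) k = (m choose Suc f) * D' k" for k
      using less.IH[of m "Suc f" k] 4 by (simp add: l_def D'_def)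
    \<comment> \<open>The weight \<open>Suc f\<close> here and the single fixed point in
      \<open>ih''\<close> both produce the factor \<open>l\<close>, so this term matches its
      counterpart in the recurrence for size \<open>Suc l\<close>.\<close>
    then have ih': "Suc f * num_fix_exc m (Suc f) k = l * c * D' k" for k
      using Suc_times_binomial_Suc[of f m] by (simp only: l_def c_def mult.assoc[symmetric])
    have ih'': "num_fix_exc l (Suc 0) k = l * D' k" for k
      using less.IH[of l 1 k] 4 by (simp add: l_def D'_def)
    have "num_fix_exc (Suc l) 0 k = 2 * k * D k
        + (if k = 0 then 0 else (2 * (Suc l - k) + 1) * D (k - 1) + 2 * l * D' (k - 1))"
      by (simp add: num_fix_exc_Suc[of l] ih'' D_def)
    moreover have "num_fix_exc n f k = (m choose g) * num_fix_exc (Suc l) 0 k + 2 * k * (c * D k)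
        + (if k = 0 then 0 else (2 * (Suc l - k) + 1) * (c * D (k - 1)) + 2 * (l * c * D' (k - 1)))"
    proof -
      have fg: "(f = 0) = False" "f - 1 = g" using 4 by simp_all
      have "num_fix_exc n f k = num_fix_exc m g k + 2 * k * num_fix_exc m f k
          + (if k = 0 then 0 else (2 * (Suc m - k - f) + 1) * num_fix_exc m f (k - 1)
               + 2 * (Suc f * num_fix_exc m (Suc f) (k - 1)))"
        by (simp only: 4(1) num_fix_exc_Suc[of m f k] fg if_False mult.assoc)
      then show ?thesis unfolding ih ih' l .
    qed
    moreover have "n choose f = (m choose g) + c" using 4 by (simp add: c_def)
    ultimately show ?thesis by (simp add: l algebra_simps)
  qed
qed

section \<open>The derangement numbers and their recurrence\<close>

lemma num_derB_eq_num_fix_exc: "num_derB n k = num_fix_exc n 0 k"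
proof -
  have "card (fix_set n \<sigma>) = 0 \<longleftrightarrow> (\<forall>i\<in>{1..n}. \<sigma> i \<noteq> int i)" for \<sigma>
    using finite_subset[OF exc_fix_subset(2)[of n \<sigma>]] by (auto simp: fix_set_def)
  then show ?thesis
    by (simp add: num_derB_def num_fix_exc_def derangementsB_def excB_def exc_set_def)
qed

lemma num_derB_0_0: "num_derB 0 0 = 1"
  by (simp add: num_derB_eq_num_fix_exc num_fix_exc_0)

lemma num_derB_Suc_0: "num_derB (Suc m) 0 = 0"
  by (simp add: num_derB_eq_num_fix_exc num_fix_exc_Suc)

lemma num_derB_eq_0: "n < k \<Longrightarrow> num_derB n k = 0"
  by (simp add: num_derB_eq_num_fix_exc num_fix_exc_eq_0)

text \<open>The last term stems from signed permutations with exactly one fixed point: it has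
  \<open>m\<close> possible places, and a letter of either sign inserted there destroys it.\<close>

lemma num_derB_Suc_Suc:
  "num_derB (Suc m) (Suc k) = 2 * Suc k * num_derB m (Suc k)
     + (2 * (m - k) + 1) * num_derB m k + 2 * m * num_derB (m - 1) k"
  by (simp add: num_derB_eq_num_fix_exc num_fix_exc_Suc[of m] num_fix_exc_eq_binomial[of m "Suc 0"])

text \<open>Serves the bottom of the spiral, where index 0 with count 0 precedes index
  \<open>n\<close>.\<close>

lemma num_derB_diag_pos: "num_derB n n > 0"
  by (induction n) (simp_all add: num_derB_0_0 num_derB_Suc_Suc)

section \<open>The two inequalities of the spiral\<close>

text \<open>For positive \<open>k\<close>, each inequality for \<open>n\<close> rests on both
  inequalities for \<open>n - 1\<close> and on its own kind for \<open>n - 2\<close>. The second one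
  admits \<open>k = 0\<close>, since the step for \<open>k = 1\<close> refers to index 0.\<close>

lemma num_derB_spiral:
  shows "k \<ge> 1 \<Longrightarrow> k < j \<Longrightarrow> j + k = n + 1 \<Longrightarrow> num_derB n j < num_derB n k"
    and "k < j \<Longrightarrow> j + k = n \<Longrightarrow> num_derB n k < num_derB n j"
proof (induction n arbitrary: j k rule: less_induct)
  case (less n)
  \<comment> \<open>The weak form also covers the meeting point \<open>j = k\<close> and, for
    \<open>k = 0\<close>, the index \<open>m + 1\<close>, where the count is 0.\<close>
  have le1: "num_derB m j \<le> num_derB m k" if "m < n" "k \<le> j" "j + k = m + 1" for m j k
  proof (cases "k = 0 \<or> j = k")
    case True
    then show ?thesis using that by (auto simp: num_derB_eq_0)
  next
    case False
    then show ?thesis using less(1)[OF that(1), of k j] that by simp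
  qed
  have le2: "num_derB m k \<le> num_derB m j" if "m < n" "k \<le> j" "j + k = m" for m j k
    using less(2)[OF that(1), of k j] that by (cases "j = k") auto
  {
    case 1
    then obtain j' k' where jk: "j = Suc j'" "k = Suc k'" by (cases j; cases k) auto
    with 1 obtain m where n: "n = Suc m" by (cases n) auto
    have m: "j' + k' = m" "k' < j'" "m - k' = j'" "m - j' = k'" "m \<ge> 1" using 1 jk n by auto
    let ?d = "num_derB m"
    have c: "?d (Suc j') \<le> ?d k'" "?d k' < ?d j'" "?d j' \<le> ?d (Suc k')"
      using le1[of m k' "Suc j'"] less(2)[of m k' j'] le1[of m "Suc k'" j'] m n by simp_all
    \<comment> \<open>Both indices drop by 1 and the size by 2, so
      \<open>j' + k' = (m - 1) + 1\<close> is again a reflection of the first kind.\<close>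
    have "num_derB (m - 1) j' \<le> num_derB (m - 1) k'"
      using le1[of "m - 1" k' j'] m n by simp
    then have "2 * m * num_derB (m - 1) j' \<le> 2 * m * num_derB (m - 1) k'"
      by (rule mult_le_mono2)
    moreover have "(2 * j' + 1) * ?d (Suc j') \<le> (2 * j' + 1) * ?d k'"
      "(2 * k' + 1) * ?d j' \<le> (2 * k' + 1) * ?d (Suc k')"
      using c by (intro mult_le_mono2; simp)+
    \<comment> \<open>One unit of weight is split off on each side so that the rest pairs off with
      equal weights. The units compare \<open>?d (Suc j')\<close> with \<open>?d (Suc k')\<close>,
      the two ends of the chain \<open>c\<close>, and this gives strictness.\<close>
    moreover have "num_derB n j = (2 * j' + 1) * ?d (Suc j') + ?d (Suc j')
        + (2 * k' + 1) * ?d j' + 2 * m * num_derB (m - 1) j'"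
      "num_derB n k = (2 * k' + 1) * ?d (Suc k') + ?d (Suc k')
        + (2 * j' + 1) * ?d k' + 2 * m * num_derB (m - 1) k'"
      by (simp_all add: n jk num_derB_Suc_Suc m(3,4))
    ultimately show ?case using c by linarith
  next
    case 2
    show ?case
    proof (cases k)
      case 0
      with 2 show ?thesis
        using num_derB_diag_pos[of n] num_derB_Suc_0[of "n - 1"] by simp
    next
      case k: (Suc k')
      with 2 obtain j' m where jn: "j = Suc j'" "n = Suc m" by (cases j; cases n) auto
      have m: "Suc j' + k' = m" "k' < j'" "m - k' = Suc j'" "m - j' = Suc k'" "m \<ge> 1"
        using 2 jn k by auto
      let ?d = "num_derB m"
      have c: "?d k' < ?d (Suc j')" "?d (Suc j') \<le> ?d (Suc k')" "?d (Suc k') \<le> ?d j'"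
        using less(2)[of m k' "Suc j'"] le1[of m "Suc k'" "Suc j'"] le2[of m "Suc k'" j'] m jn
        by simp_all
      have "num_derB (m - 1) k' \<le> num_derB (m - 1) j'"
        using le2[of "m - 1" k' j'] m jn by simp
      then have "2 * m * num_derB (m - 1) k' \<le> 2 * m * num_derB (m - 1) j'"
        by (rule mult_le_mono2)
      moreover have "(2 * j' + 2) * ?d k' \<le> (2 * j' + 2) * ?d (Suc j')"
        "(2 * k' + 2) * ?d (Suc k') \<le> (2 * k' + 2) * ?d j'"
        using c by (intro mult_le_mono2; simp)+
      \<comment> \<open>The same split as in the first case; here the units compare
        \<open>?d k'\<close> with \<open>?d j'\<close>.\<close>
      moreover have "num_derB n j = (2 * j' + 2) * ?d (Suc j')
          + (2 * k' + 2) * ?d j' + ?d j' + 2 * m * num_derB (m - 1) j'"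
        "num_derB n k = (2 * k' + 2) * ?d (Suc k')
          + (2 * j' + 2) * ?d k' + ?d k' + 2 * m * num_derB (m - 1) k'"
        by (simp_all add: jn k num_derB_Suc_Suc m(3,4))
      ultimately show ?thesis using c by linarith
    qed
  }
qed

section \<open>Assembling the chain\<close>

text \<open>The bound by the value at \<open>t\<close> is carried along so that the next pair can be
  appended by comparing it with one entry only.\<close>

lemma sorted_num_derB_pairs:
  assumes "2 * t \<le> n"
  shows "sorted_wrt (<) (map (num_derB n) (concat (map (\<lambda>j. [n + 1 - j, j]) [1..<Suc t])))
    \<and> (\<forall>x \<in> set (concat (map (\<lambda>j. [n + 1 - j, j]) [1..<Suc t])). num_derB n x \<le> num_derB n t)"
  using assms
proof (induction t)
  case 0
  show ?case by simp
next
  case (Suc t)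
  have "num_derB n t < num_derB n (n - t)"
    by (rule num_derB_spiral(2)) (use Suc.prems in auto)
  moreover have "num_derB n (n - t) < num_derB n (Suc t)"
    by (rule num_derB_spiral(1)) (use Suc.prems in auto)
  ultimately show ?case
    using Suc by (fastforce simp: sorted_wrt_append)
qed

theorem theorem4p6:
  fixes n :: nat
  assumes "n \<ge> 2"
  shows "sorted_wrt (<) (map (num_derB n) (chain_indices n))
    \<and> (\<forall>k. 1 \<le> k \<and> k \<le> half_bound n \<longrightarrow> num_derB n (n + 1 - k) < num_derB n k \<and> num_derB n k < num_derB n (n - k))
    \<and> (even n \<longrightarrow> num_derB n (n div 2 + 1) < num_derB n (n div 2))"
proof (intro conjI allI impI)
  let ?t = "n div 2"
  have pairs: "sorted_wrt (<) (map (num_derB n) (concat (map (\<lambda>j. [n + 1 - j, j]) [1..<Suc ?t])))"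
    "\<forall>x \<in> set (concat (map (\<lambda>j. [n + 1 - j, j]) [1..<Suc ?t])). num_derB n x \<le> num_derB n ?t"
    using sorted_num_derB_pairs[of ?t n] by auto
  show "sorted_wrt (<) (map (num_derB n) (chain_indices n))"
  proof (cases "odd n")
    case True
    \<comment> \<open>For odd \<open>n\<close> the middle index is \<open>n - n div 2\<close>, so
      appending it is one more instance of the second inequality.\<close>
    have "num_derB n ?t < num_derB n ((n + 1) div 2)"
      by (rule num_derB_spiral(2)) (use True in presburger)+
    then show ?thesis
      using pairs True by (fastforce simp: chain_indices_def sorted_wrt_append)
  next
    case False
    then show ?thesis using pairs by (simp add: chain_indices_def)
  qed
next
  fix k assume "1 \<le> k \<and> k \<le> half_bound n"
  then have k: "1 \<le> k" "2 * k < n"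
    using assms unfolding half_bound_def by (auto split: if_splits)
  show "num_derB n (n + 1 - k) < num_derB n k"
    by (rule num_derB_spiral(1)) (use k in auto)
  show "num_derB n k < num_derB n (n - k)"
    by (rule num_derB_spiral(2)) (use k in auto)
next
  assume "even n"
  \<comment> \<open>This pair is left out by \<open>half_bound\<close>: at
    \<open>k = n div 2\<close> the first inequality still holds, but \<open>n - k\<close> coincides
    with \<open>k\<close>.\<close>
  then show "num_derB n (n div 2 + 1) < num_derB n (n div 2)"
    using assms by (intro num_derB_spiral(1)) (auto elim!: evenE)
qed

end
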